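(* Let $P=\frac13P_1+\frac23P_2$, where $P_1$ and $P_2$ are the uniform distributions on $[0,1]$ and $[1,2]$, respectively. The set $\{0.380129,\ 1.14039,\ 1.71346\}$ forms an optimal set of three-means for $P$ with quantization error $V_3=0.0343006$, where the displayed decimals are roundings of exact real values; that is, there is an optimal set of three-means $\{a_1<a_2<a_3\}$ for $P$ such that $a_1$ rounded to six decimal places is $0.380129$, $a_2$ and $a_3$ rounded to five decimal places are $1.14039$ and $1.71346$, and $V_3$ rounded to seven decimal places is $0.0343006$.
   Context: For a Borel probability measure $P$ on $\mathbb{R}$ and $n\in\mathbb{N}$, the $n$th quantization error is $V_n=V_n(P)=\inf\{\int\min_{a\in\alpha}(x-a)^2\,dP(x) : \alpha\subset\mathbb{R},\ 1\le\mathrm{card}(\alpha)\le n\}$, and an optimal set of $n$-means for $P$ is a set $\alpha$ with $1\le\mathrm{card}(\alpha)\le n$ attaining this infimum. *)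

theory Defs
  imports "HOL-Probability.Probability"
begin

text \<open>The distortion takes values in \<^typ>\<open>ennreal\<close>, so that a non-integrable distance
  function gets the value \<open>\<infinity>\<close>; the Bochner integral would give it the value \<open>0\<close>.\<close>

definition distortion :: "real measure \<Rightarrow> real set \<Rightarrow> ennreal" where
  "distortion P \<alpha> = (\<integral>\<^sup>+ x. ennreal (Min ((\<lambda>a. (x - a)\<^sup>2) ` \<alpha>)) \<partial>P)"

text \<open>The condition \<open>1 \<le> card \<alpha>\<close> forces \<open>\<alpha>\<close> to be finite and nonempty.\<close>

definition quantization_error :: "nat \<Rightarrow> real measure \<Rightarrow> ennreal" where
  "quantization_error n P = (INF \<alpha> \<in> {\<alpha>. 1 \<le> card \<alpha> \<and> card \<alpha> \<le> n}. distortion P \<alpha>)"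

definition optimal_set_of_means :: "nat \<Rightarrow> real measure \<Rightarrow> real set \<Rightarrow> bool" where
  "optimal_set_of_means n P \<alpha> \<longleftrightarrow>
     1 \<le> card \<alpha> \<and> card \<alpha> \<le> n \<and> distortion P \<alpha> = quantization_error n P"

definition mixture :: "real \<Rightarrow> 'a measure \<Rightarrow> real \<Rightarrow> 'a measure \<Rightarrow> 'a measure" where
  "mixture p M q N =
     measure_of (space M) (sets M) (\<lambda>A. ennreal p * emeasure M A + ennreal q * emeasure N A)"

text \<open>Since \<^const>\<open>measure_of\<close> silently yields the zero measure when the given set function
  is not a measure, we check that this does not happen.\<close>

lemma sets_mixture [simp, measurable_cong]: "sets (mixture p M q N) = sets M"
  by (simp add: mixture_def)

lemma space_mixture [simp]: "space (mixture p M q N) = space M"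
  by (simp add: mixture_def)

lemma emeasure_mixture:
  assumes "sets N = sets M" and "A \<in> sets M"
  shows "emeasure (mixture p M q N) A = ennreal p * emeasure M A + ennreal q * emeasure N A"
proof (rule emeasure_measure_of [OF mixture_def])
  show "sets M \<subseteq> Pow (space M)"
    by (rule sets.space_closed)
  show "A \<in> sets (mixture p M q N)"
    using assms by simp
  show "positive (sets (mixture p M q N))
          (\<lambda>A. ennreal p * emeasure M A + ennreal q * emeasure N A)"
    by (simp add: positive_def)
  show "countably_additive (sets (mixture p M q N))
          (\<lambda>A. ennreal p * emeasure M A + ennreal q * emeasure N A)"
  proof (rule countably_additiveI)
    fix B :: "nat \<Rightarrow> 'a set"
    assume B: "range B \<subseteq> sets (mixture p M q N)" "disjoint_family B"
    then have "(\<Sum>i. emeasure M (B i)) = emeasure M (\<Union>i. B i)"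
      and "(\<Sum>i. emeasure N (B i)) = emeasure N (\<Union>i. B i)"
      using assms(1) by (auto intro!: suminf_emeasure)
    then show "(\<Sum>i. ennreal p * emeasure M (B i) + ennreal q * emeasure N (B i))
        = ennreal p * emeasure M (\<Union>i. B i) + ennreal q * emeasure N (\<Union>i. B i)"
      by (simp add: suminf_add [symmetric])
  qed
qed

definition P_mix :: "real measure" where
  "P_mix = mixture (1/3) (uniform_measure lborel {0..1}) (2/3) (uniform_measure lborel {1..2})"

lemma sets_P_mix [simp, measurable_cong]: "sets P_mix = sets borel"
  by (simp add: P_mix_def)

lemma prob_space_P_mix: "prob_space P_mix"
proof
  have "ennreal (1/3) + ennreal (2/3) = 1"
    by (subst ennreal_plus [symmetric]) auto
  moreover have "emeasure (uniform_measure lborel {0..1::real}) UNIV = 1"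
    and "emeasure (uniform_measure lborel {1..2::real}) UNIV = 1"
    by simp_all
  ultimately show "emeasure P_mix (space P_mix) = 1"
    by (simp add: P_mix_def emeasure_mixture)
qed

definition rounds_to :: "nat \<Rightarrow> real \<Rightarrow> real \<Rightarrow> bool" where
  "rounds_to d x r \<longleftrightarrow> of_int (round (10 ^ d * x)) / 10 ^ d = r"

end

theory Submission
  imports Defs
begin

text \<open>Write a codebook with at most three points as \<open>a \<le> b \<le> c\<close>. The essential case is the one in
  which the Voronoi boundaries satisfy \<open>(a + b) / 2 \<le> 1 \<le> (b + c) / 2\<close>, so that the density changes
  inside the cell of \<open>b\<close>. Then \<open>c\<close> is irrelevant on \<open>[0, 1]\<close> and \<open>a\<close> is irrelevant on \<open>[1, 2]\<close>, and the
  two halves interact only through \<open>b\<close>. For fixed \<open>b\<close>, each outer point can be optimised by itself: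
  if the stretch of length \<open>s\<close> between \<open>b\<close> and an end of the support is divided into a cell of length
  \<open>x\<close> around the outer point and a half cell of length \<open>y\<close> next to \<open>b\<close>, its cost is
  \<open>x\<^sup>3 / 12 + y\<^sup>3 / 3\<close> per unit density, which is least for \<open>x = 2 * y\<close>, with value \<open>s\<^sup>3 / 27\<close>
  (\<open>cube_plus_four_cube_ge\<close>, \<open>integral_min_sq_ge_left\<close>). What remains is a cubic in \<open>b\<close>,
  \<open>mid_poly\<close>, whose minimum over \<open>b \<ge> 0\<close> is at \<open>b = (5 + sqrt 17) / 8\<close>; the matching outer points
  are \<open>b / 3\<close> and \<open>2 - (2 - b) / 3\<close>, and all the decimals follow from this closed form.

  The other cases are worse by a margin. In the essential case, a middle point outside \<open>[0, 2]\<close>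
  forces all three points outside \<open>[0, 2]\<close>. If \<open>(b + c) / 2 < 1\<close>, then \<open>c\<close> alone serves
  \<open>[1, 2]\<close>. If \<open>(a + b) / 2 > 1\<close>, then \<open>a\<close> alone serves \<open>[0, 1]\<close>; this is expensive
  enough by itself if \<open>a > 1\<close>, and if \<open>a \<le> 1\<close>, then \<open>a\<close> helps on \<open>[1, 2]\<close> at most as much as a point at \<open>1\<close> would
  (\<open>integral_sqdist3_ge_anchored\<close>).\<close>

section \<open>The distortion as a sum of two Riemann integrals\<close>

lemma P_mix_eq_density:
  "P_mix = density lborel
     (\<lambda>x. ennreal (1/3) * indicator {0..1} x + ennreal (2/3) * indicator {1..2} x)"
proof (rule measure_eqI)
  show "sets P_mix = sets (density lborel
      (\<lambda>x. ennreal (1/3) * indicator {0..1} x + ennreal (2/3) * indicator {1..2} x))"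
    by simp
  fix A :: "real set"
  assume "A \<in> sets P_mix"
  then have A [measurable]: "A \<in> sets borel" by simp
  have "emeasure (density lborel
      (\<lambda>x. ennreal (1/3) * indicator {0..1} x + ennreal (2/3) * indicator {1..2} x)) A
    = (\<integral>\<^sup>+x. ennreal (1/3) * indicator ({0..1} \<inter> A) x
          + ennreal (2/3) * indicator ({1..2} \<inter> A) x \<partial>lborel)"
    by (subst emeasure_density) (auto intro!: nn_integral_cong simp: indicator_def)
  also have "\<dots> = ennreal (1/3) * emeasure lborel ({0..1} \<inter> A)
      + ennreal (2/3) * emeasure lborel ({1..2} \<inter> A)"
    by (simp add: nn_integral_add nn_integral_cmult_indicator)
  also have "\<dots> = emeasure P_mix A"
    by (simp add: P_mix_def emeasure_mixture divide_ennreal_def)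
  finally show "emeasure P_mix A = emeasure (density lborel
      (\<lambda>x. ennreal (1/3) * indicator {0..1} x + ennreal (2/3) * indicator {1..2} x)) A"
    by simp
qed

text \<open>The distortion is a nonnegative Lebesgue integral, while the cell computations below are done
  with antiderivatives; this connects the two.\<close>

lemma nn_integral_Icc_eq_integral:
  fixes f :: "real \<Rightarrow> real"
  assumes cont: "continuous_on UNIV f" and nonneg: "\<And>x. 0 \<le> f x"
  shows "(\<integral>\<^sup>+x. ennreal (f x) * indicator {l..r} x \<partial>lborel) = ennreal (integral {l..r} f)"
proof -
  have "(f has_integral integral {l..r} f) {l..r}"
    by (rule integrable_integral, rule integrable_continuous_real)
       (rule continuous_on_subset [OF cont], simp)
  moreover have "(\<lambda>x. f x * indicator {l..r} x) = (\<lambda>x. if x \<in> {l..r} then f x else 0)"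
    by auto
  ultimately have "((\<lambda>x. f x * indicator {l..r} x) has_integral integral {l..r} f) UNIV"
    by (simp only: has_integral_restrict_UNIV)
  moreover have [measurable]: "f \<in> borel_measurable borel"
    using cont by (rule borel_measurable_continuous_onI)
  ultimately have "(\<integral>\<^sup>+x. ennreal (f x * indicator {l..r} x) \<partial>lborel)
      = ennreal (integral {l..r} f)"
    by (intro nn_integral_has_integral_lborel) (auto simp: nonneg)
  then show ?thesis
    by (simp add: ennreal_mult' ennreal_indicator nonneg)
qed

text \<open>The points may coincide, so that codebooks with one or two points are covered as well.\<close>

definition sqdist3 :: "real \<Rightarrow> real \<Rightarrow> real \<Rightarrow> real \<Rightarrow> real" where
  "sqdist3 a b c x = min ((x - a)\<^sup>2) (min ((x - b)\<^sup>2) ((x - c)\<^sup>2))"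

definition distortion3 :: "real \<Rightarrow> real \<Rightarrow> real \<Rightarrow> real" where
  "distortion3 a b c =
     integral {0..1} (sqdist3 a b c) / 3 + 2 * integral {1..2} (sqdist3 a b c) / 3"

lemma sqdist3_nonneg: "0 \<le> sqdist3 a b c x"
  by (simp add: sqdist3_def)

lemma continuous_on_sqdist3: "continuous_on S (sqdist3 a b c)"
  unfolding sqdist3_def by (intro continuous_intros)

lemma integrable_sqdist3: "sqdist3 a b c integrable_on {l..r}"
  by (intro integrable_continuous_real continuous_on_sqdist3)

lemma integral_sqdist3_nonneg: "0 \<le> integral {l..r} (sqdist3 a b c)"
  by (intro integral_nonneg integrable_sqdist3) (simp add: sqdist3_nonneg)

lemma distortion_P_mix: "distortion P_mix {a, b, c} = ennreal (distortion3 a b c)"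
proof -
  have [measurable]: "sqdist3 a b c \<in> borel_measurable borel"
    by (rule borel_measurable_continuous_onI) (rule continuous_on_sqdist3)
  have "distortion P_mix {a, b, c} = (\<integral>\<^sup>+x. ennreal (sqdist3 a b c x) \<partial>P_mix)"
    by (simp add: distortion_def sqdist3_def)
  also have "\<dots> = (\<integral>\<^sup>+x. ennreal (1/3) * (ennreal (sqdist3 a b c x) * indicator {0..1} x)
      + ennreal (2/3) * (ennreal (sqdist3 a b c x) * indicator {1..2} x) \<partial>lborel)"
    unfolding P_mix_eq_density
    by (subst nn_integral_density) (auto intro!: nn_integral_cong simp: algebra_simps)
  also have "\<dots> = ennreal (1/3) * ennreal (integral {0..1} (sqdist3 a b c))
      + ennreal (2/3) * ennreal (integral {1..2} (sqdist3 a b c))"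
    by (subst nn_integral_add)
       (auto simp: nn_integral_cmult nn_integral_Icc_eq_integral continuous_on_sqdist3
         sqdist3_nonneg)
  also have "\<dots> = ennreal (distortion3 a b c)"
    by (simp add: distortion3_def integral_sqdist3_nonneg ennreal_plus
        flip: ennreal_mult')
  finally show ?thesis .
qed

section \<open>Integrals over cells\<close>

lemma has_integral_sq:
  fixes a :: real
  assumes "l \<le> r"
  shows "((\<lambda>x. (x - a)\<^sup>2) has_integral ((r - a)^3 - (l - a)^3) / 3) {l..r}"
proof -
  have "((\<lambda>x. (x - a)\<^sup>2) has_integral (r - a)^3 / 3 - (l - a)^3 / 3) {l..r}"
    by (rule fundamental_theorem_of_calculus [OF assms])
       (auto intro!: derivative_eq_intros
          simp flip: has_real_derivative_iff_has_vector_derivative)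
  then show ?thesis by (simp add: diff_divide_distrib)
qed

text \<open>The midpoint of the interval is the best single centre.\<close>

lemma integral_sq_ge:
  fixes a :: real
  assumes "l \<le> r"
  shows "((r - l)^3) / 12 \<le> integral {l..r} (\<lambda>x. (x - a)\<^sup>2)"
proof -
  \<comment> \<open>Parallel axis identity: the excess over the variance is the squared offset from the mean.\<close>
  have "((r - a)^3 - (l - a)^3) / 3 - (r - l)^3 / 12 = (r - l) * (((l + r) / 2 - a)\<^sup>2)"
    by (simp add: field_simps power2_eq_square power3_eq_cube)
  then show ?thesis
    using integral_unique [OF has_integral_sq [OF assms, of a]] assms
    by (smt (verit) mult_nonneg_nonneg zero_le_power2)
qed

lemma sq_le_sq_iff_midpoint:
  fixes p q x :: real
  assumes "p < q"
  shows "(x - p)\<^sup>2 \<le> (x - q)\<^sup>2 \<longleftrightarrow> x \<le> (p + q) / 2"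
proof -
  have "(x - q)\<^sup>2 - (x - p)\<^sup>2 = 2 * (q - p) * ((p + q) / 2 - x)"
    by (simp add: field_simps power2_eq_square)
  then show ?thesis
    using assms by (smt (verit) mult_nonneg_nonneg mult_pos_neg)
qed

lemma sq_le_sq_left:
  fixes p q x :: real
  assumes "p \<le> q" "x \<le> (p + q) / 2"
  shows "(x - p)\<^sup>2 \<le> (x - q)\<^sup>2"
  using sq_le_sq_iff_midpoint [of p q x] assms by (cases "p = q") auto

lemma sq_le_sq_right:
  fixes p q x :: real
  assumes "p \<le> q" "(p + q) / 2 \<le> x"
  shows "(x - q)\<^sup>2 \<le> (x - p)\<^sup>2"
  using sq_le_sq_left [of "-q" "-p" "-x"] assms by (simp add: power2_commute)

lemma integral_min_sq:
  fixes p q :: real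
  assumes "p \<le> q" "l \<le> (p + q) / 2" "(p + q) / 2 \<le> r"
  shows "integral {l..r} (\<lambda>x. min ((x - p)\<^sup>2) ((x - q)\<^sup>2))
    = (((q - p) / 2)^3 * 2 + (p - l)^3 + (r - q)^3) / 3"
proof -
  let ?d = "(p + q) / 2" and ?m = "\<lambda>x. min ((x - p)\<^sup>2) ((x - q)\<^sup>2)"
  have "integral {l..r} ?m = integral {l..?d} ?m + integral {?d..r} ?m"
    by (rule Henstock_Kurzweil_Integration.integral_combine [symmetric, OF assms(2,3)])
       (intro integrable_continuous_real continuous_intros)
  also have "integral {l..?d} ?m = integral {l..?d} (\<lambda>x. (x - p)\<^sup>2)"
    by (intro integral_cong min_absorb1 sq_le_sq_left [OF assms(1)]) simp
  also have "\<dots> = ((?d - p)^3 - (l - p)^3) / 3"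
    by (rule integral_unique, rule has_integral_sq) (use assms in simp)
  also have "integral {?d..r} ?m = integral {?d..r} (\<lambda>x. (x - q)\<^sup>2)"
    by (intro integral_cong min_absorb2 sq_le_sq_right [OF assms(1)]) simp
  also have "\<dots> = ((r - q)^3 - (?d - q)^3) / 3"
    by (rule integral_unique, rule has_integral_sq) (use assms in simp)
  finally show ?thesis
    by (simp add: field_simps power3_eq_cube)
qed

text \<open>Minimum of the cost \<open>x\<^sup>3 + 4 * y\<^sup>3\<close> on the line \<open>x + y = s\<close>; the double zero of
  the difference at \<open>x = 2 * y\<close> says that an optimal boundary makes a full cell twice as long as the
  half cell beside it.\<close>

lemma cube_plus_four_cube_ge:
  fixes x y :: real
  assumes "0 \<le> x" "0 \<le> y"
  shows "4 * (x + y)^3 / 9 \<le> x^3 + 4 * y^3"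
proof -
  have "x^3 + 4 * y^3 - 4 * (x + y)^3 / 9 = (x - 2 * y)\<^sup>2 * (5 * x + 8 * y) / 9"
    by (simp add: field_simps power2_eq_square power3_eq_cube)
  moreover have "0 \<le> (x - 2 * y)\<^sup>2 * (5 * x + 8 * y) / 9"
    using assms by (intro divide_nonneg_nonneg mult_nonneg_nonneg) auto
  ultimately show ?thesis by linarith
qed

text \<open>The bound does not mention \<open>p\<close>: the best outer point lies one third of the way from \<open>l\<close> to \<open>q\<close>,
  and gives equality if the boundary, two thirds of the way, is at most \<open>r\<close>. The term \<open>(r - q)^3\<close> is the part of the cell of \<open>q\<close>
  beyond \<open>q\<close>; it is negative for \<open>q > r\<close>, when that cell is cut off at \<open>r\<close>.\<close>

lemma integral_min_sq_ge_left:
  fixes p q :: real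
  assumes "p \<le> q" "l \<le> q" "(p + q) / 2 \<le> r" "l \<le> r"
  shows "((q - l)^3 + 9 * (r - q)^3) / 27 \<le> integral {l..r} (\<lambda>x. min ((x - p)\<^sup>2) ((x - q)\<^sup>2))"
proof (cases "l \<le> (p + q) / 2")
  case True
  define x y where "x = (p + q) / 2 - l" and "y = (q - p) / 2"
  have "4 * (x + y)^3 / 9 \<le> x^3 + 4 * y^3"
    by (rule cube_plus_four_cube_ge) (use True assms in \<open>auto simp: x_def y_def\<close>)
  moreover have "x + y = q - l" by (simp add: x_def y_def field_simps)
  ultimately have 1: "4 * (q - l)^3 / 9 \<le> x^3 + 4 * y^3" by simp
  have pl: "p - l = x - y" by (simp add: x_def y_def field_simps)
  \<comment> \<open>Moving \<open>p\<close> to the centre of its cell lowers the cost of that cell to \<open>x^3 / 12\<close>.\<close>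
  have "4 * (y^3 + (p - l)^3) - x^3 = 3 * x * (x - 2 * y)\<^sup>2"
    unfolding pl by (simp add: algebra_simps power2_eq_square power3_eq_cube)
  moreover have "0 \<le> 3 * x * (x - 2 * y)\<^sup>2"
    by (intro mult_nonneg_nonneg) (use True in \<open>auto simp: x_def\<close>)
  ultimately have "x^3 \<le> 4 * (y^3 + (p - l)^3)" by linarith
  with 1 show ?thesis
    unfolding integral_min_sq [OF assms(1) True assms(3)] y_def [symmetric] by (simp add: add_divide_distrib)
next
  case False
  \<comment> \<open>Now the whole cell of \<open>p\<close> lies to the left of \<open>l\<close>, and \<open>q\<close> serves the interval alone.\<close>
  have "integral {l..r} (\<lambda>x. min ((x - p)\<^sup>2) ((x - q)\<^sup>2)) = integral {l..r} (\<lambda>x. (x - q)\<^sup>2)"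
    by (intro integral_cong min_absorb2 sq_le_sq_right [OF assms(1)]) (use False in simp)
  also have "\<dots> = ((r - q)^3 - (l - q)^3) / 3"
    by (rule integral_unique, rule has_integral_sq) (use assms in simp)
  also have "\<dots> = ((r - q)^3 + (q - l)^3) / 3"
    by (simp add: field_simps power3_eq_cube)
  finally have *: "integral {l..r} (\<lambda>x. min ((x - p)\<^sup>2) ((x - q)\<^sup>2)) = ((r - q)^3 + (q - l)^3) / 3" .
  have "0 \<le> (q - l)^3" using assms by simp
  then show ?thesis unfolding * by simp
qed

lemma integral_min_sq_ge_right:
  fixes p q :: real
  assumes "p \<le> q" "p \<le> r" "l \<le> (p + q) / 2" "l \<le> r"
  shows "((r - p)^3 + 9 * (p - l)^3) / 27 \<le> integral {l..r} (\<lambda>x. min ((x - p)\<^sup>2) ((x - q)\<^sup>2))"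
proof -
  have "integral {l..r} (\<lambda>x. min ((x - p)\<^sup>2) ((x - q)\<^sup>2))
      = integral {-r..-l} (\<lambda>x. min ((- x - p)\<^sup>2) ((- x - q)\<^sup>2))"
    by (rule Henstock_Kurzweil_Integration.integral_reflect_real [symmetric])
  also have "(\<lambda>x. min ((- x - p)\<^sup>2) ((- x - q)\<^sup>2)) = (\<lambda>x. min ((x - - q)\<^sup>2) ((x - - p)\<^sup>2))"
    by (auto simp: fun_eq_iff min.commute power2_eq_square algebra_simps)
  also have "integral {-r..-l} \<dots> \<ge> (((-p) - (-r))^3 + 9 * ((-l) - (-p))^3) / 27"
    by (rule integral_min_sq_ge_left) (use assms in auto)
  finally show ?thesis by simp
qed

text \<open>The cap \<open>h\<^sup>2 - (x - a)\<^sup>2\<close> near a centre is what that centre saves against the constant cost \<open>h\<^sup>2\<close>.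
  Over any interval it saves at most the integral over all of the range \<open>{p..q}\<close> where it is counted.\<close>

lemma integral_cap_le:
  fixes l r p q :: real
  assumes "p \<le> q" and "\<And>x. p \<le> x \<Longrightarrow> x \<le> q \<Longrightarrow> \<bar>x - a\<bar> \<le> h"
  shows "(\<lambda>x. if x \<in> {p..q} then h\<^sup>2 - (x - a)\<^sup>2 else 0) integrable_on {l..r}"
    and "integral {l..r} (\<lambda>x. if x \<in> {p..q} then h\<^sup>2 - (x - a)\<^sup>2 else 0)
      \<le> h\<^sup>2 * (q - p) - ((q - a)^3 - (p - a)^3) / 3"
proof -
  let ?f = "\<lambda>x. if x \<in> {p..q} then h\<^sup>2 - (x - a)\<^sup>2 else 0"
  have "((\<lambda>x. h\<^sup>2 - (x - a)\<^sup>2) has_integral h\<^sup>2 * (q - p) - ((q - a)^3 - (p - a)^3) / 3) {p..q}"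
    using has_integral_diff [OF has_integral_const_real [of "h\<^sup>2" p q] has_integral_sq [OF assms(1)]]
      assms(1) by (simp add: mult.commute)
  then have int: "(?f has_integral h\<^sup>2 * (q - p) - ((q - a)^3 - (p - a)^3) / 3) UNIV"
    by (simp only: has_integral_restrict_UNIV)
  then show sub: "?f integrable_on {l..r}"
    by (meson has_integral_integrable integrable_on_subinterval subset_UNIV)
  have nonneg: "0 \<le> ?f x" for x
  proof (cases "x \<in> {p..q}")
    case True
    then have "\<bar>x - a\<bar> \<le> \<bar>h\<bar>" using assms(2) [of x] by force
    then show ?thesis using True by (simp add: abs_le_square_iff)
  qed auto
  have "integral {l..r} ?f \<le> integral UNIV ?f"
    by (rule integral_subset_le [OF _ sub has_integral_integrable [OF int]]) (use nonneg in auto)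
  with int show "integral {l..r} ?f \<le> h\<^sup>2 * (q - p) - ((q - a)^3 - (p - a)^3) / 3"
    by (simp add: integral_unique)
qed

text \<open>A bound without any case distinction on the order of the cells: the squared distance to the
  nearest point is at least \<open>h\<^sup>2\<close> minus the sum of the caps of all points. The points \<open>b\<close> and \<open>c\<close> save
  at most \<open>4 * h^3 / 3\<close> each, and \<open>a\<close>, which is no closer to the interval than its end \<open>l\<close>, saves at
  most half of that. The best \<open>h\<close> is \<open>(r - l) / 5\<close>: two full cells and one half cell fill the
  interval.\<close>

lemma integral_sqdist3_ge_anchored:
  assumes "a \<le> l" "l \<le> r" "0 \<le> h"
  shows "h\<^sup>2 * (r - l) - 10 * h^3 / 3 \<le> integral {l..r} (sqdist3 a b c)"
proof -
  define cap where "cap p q z = (\<lambda>x::real. if x \<in> {p..q} then h\<^sup>2 - (x - z)\<^sup>2 else 0)" for p q z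
  let ?A = "cap l (l + h) l" and ?B = "cap (b - h) (b + h) b" and ?C = "cap (c - h) (c + h) c"
  have A: "?A integrable_on {l..r}" "integral {l..r} ?A \<le> 2 * h^3 / 3"
    using integral_cap_le [of l "l + h" l h l r] assms
    by (auto simp: cap_def power2_eq_square power3_eq_cube)
  have BC: "cap (z - h) (z + h) z integrable_on {l..r}"
    "integral {l..r} (cap (z - h) (z + h) z) \<le> 4 * h^3 / 3" for z
    using integral_cap_le [of "z - h" "z + h" z h l r] assms
    by (auto simp: cap_def power2_eq_square power3_eq_cube abs_le_iff)
  have far: "h\<^sup>2 \<le> (x - z)\<^sup>2" if "x \<notin> {z - h..z + h}" for x z
    using that assms(3) by (subst abs_le_square_iff [symmetric]) auto
  have near: "0 \<le> h\<^sup>2 - (x - z)\<^sup>2" if "x \<in> {z - h..z + h}" for x z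
    using that assms(3) abs_le_square_iff [of "x - z" h] by auto
  have cap_ge: "0 \<le> cap (z - h) (z + h) z x" "h\<^sup>2 - (x - z)\<^sup>2 \<le> cap (z - h) (z + h) z x" for x z
    using far [of x z] near [of x z] by (auto simp: cap_def)
  have capA: "0 \<le> ?A x" "h\<^sup>2 - (x - a)\<^sup>2 \<le> ?A x" if "l \<le> x" for x
  proof -
    have "(x - l)\<^sup>2 \<le> (x - a)\<^sup>2" using that assms by (intro power_mono) auto
    then show "0 \<le> ?A x" "h\<^sup>2 - (x - a)\<^sup>2 \<le> ?A x"
      using far [of x l] near [of x l] that assms(3) unfolding cap_def
      by (smt (verit) atLeastAtMost_iff)+
  qed
  have "((\<lambda>x. h\<^sup>2 - (?A x + ?B x + ?C x)) has_integral
      h\<^sup>2 * (r - l) - (integral {l..r} ?A + integral {l..r} ?B + integral {l..r} ?C)) {l..r}"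
    using has_integral_diff [OF has_integral_const_real [of "h\<^sup>2" l r]
        has_integral_add [OF has_integral_add [OF integrable_integral [OF A(1)]
          integrable_integral [OF BC(1) [of b]]] integrable_integral [OF BC(1) [of c]]]] assms(2)
    by (simp add: mult.commute)
  then have "h\<^sup>2 * (r - l) - (integral {l..r} ?A + integral {l..r} ?B + integral {l..r} ?C)
      \<le> integral {l..r} (sqdist3 a b c)"
  proof (rule has_integral_le [OF _ integrable_integral [OF integrable_sqdist3]])
    fix x assume "x \<in> {l..r}"
    then have "l \<le> x" by simp
    then show "h\<^sup>2 - (?A x + ?B x + ?C x) \<le> sqdist3 a b c x"
      using capA [of x] cap_ge [where x = x and z = b] cap_ge [where x = x and z = c]
      unfolding sqdist3_def min_def by argo
  qed
  then show ?thesis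
    using A(2) BC(2) [of b] BC(2) [of c] by linarith
qed

section \<open>The optimal codebook\<close>

definition opt_mid :: real where
  "opt_mid = (5 + sqrt 17) / 8"

text \<open>The distortion of the best codebook with middle point \<open>b\<close>, as long as the density changes inside
  the cell of \<open>b\<close>: the expansion of
  \<open>(b^3 + 9 * (1 - b)^3) / 81 + 2 * ((2 - b)^3 + 9 * (b - 1)^3) / 81\<close>.\<close>

definition mid_poly :: "real \<Rightarrow> real" where
  "mid_poly b = (8 * b^3 - 15 * b\<^sup>2 + 3 * b + 7) / 81"

lemma sqrt17_bounds: "4.12310562 < sqrt (17::real)" "sqrt (17::real) < 4.12310563"
  by (rule real_less_rsqrt real_less_lsqrt; simp add: power2_eq_square)+

lemma opt_mid_root: "8 * opt_mid\<^sup>2 = 10 * opt_mid - 1"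
  by (simp add: opt_mid_def power2_eq_square field_simps)

lemma mid_poly_opt_mid: "mid_poly opt_mid = (61 - 34 * opt_mid) / 648"
proof -
  have "8 * opt_mid^3 = opt_mid * (10 * opt_mid - 1)"
    by (simp flip: opt_mid_root add: power2_eq_square power3_eq_cube)
  also have "\<dots> = 10 * opt_mid\<^sup>2 - opt_mid" by (simp add: power2_eq_square algebra_simps)
  finally show ?thesis
    using opt_mid_root by (simp add: mid_poly_def)
qed

text \<open>Since \<open>opt_mid\<close> is a root of the derivative, the difference has a double zero there; the third
  zero \<open>(15 - 16 * opt_mid) / 8\<close> is negative.\<close>

lemma mid_poly_ge:
  assumes "0 \<le> b"
  shows "mid_poly opt_mid \<le> mid_poly b"
proof -
  have "81 * (mid_poly b - mid_poly opt_mid) - (b - opt_mid)\<^sup>2 * (8 * b + 16 * opt_mid - 15)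
      = 3 * (8 * opt_mid\<^sup>2 - 10 * opt_mid + 1) * (b - opt_mid)"
    by (simp add: mid_poly_def field_simps power2_eq_square power3_eq_cube)
  also have "\<dots> = 0" using opt_mid_root by simp
  finally have "81 * (mid_poly b - mid_poly opt_mid) = (b - opt_mid)\<^sup>2 * (8 * b + 16 * opt_mid - 15)"
    by simp
  moreover have "0 \<le> (b - opt_mid)\<^sup>2 * (8 * b + 16 * opt_mid - 15)"
    by (intro mult_nonneg_nonneg) (use assms sqrt17_bounds in \<open>auto simp: opt_mid_def field_simps\<close>)
  ultimately show ?thesis by simp
qed

text \<open>The threshold \<open>1 / 28\<close> only has to lie between the minimum, about \<open>0.0343\<close>, and the
  distortion bounds of the other cases, the smallest of which is \<open>1/36 + 2/225\<close>.\<close>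

lemma mid_poly_opt_mid_less: "mid_poly opt_mid < 1 / 28"
  unfolding mid_poly_opt_mid using sqrt17_bounds by (simp add: opt_mid_def field_simps)

lemma integral_sqdist3_eq_left:
  assumes "a \<le> b" "b \<le> c" "r \<le> (b + c) / 2"
  shows "integral {l..r} (sqdist3 a b c) = integral {l..r} (\<lambda>x. min ((x - a)\<^sup>2) ((x - b)\<^sup>2))"
  by (rule integral_cong) (use sq_le_sq_left [OF assms(2)] assms(3) in \<open>auto simp: sqdist3_def\<close>)

lemma integral_sqdist3_eq_right:
  assumes "a \<le> b" "b \<le> c" "(a + b) / 2 \<le> l"
  shows "integral {l..r} (sqdist3 a b c) = integral {l..r} (\<lambda>x. min ((x - b)\<^sup>2) ((x - c)\<^sup>2))"
proof (rule integral_cong)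
  fix x assume "x \<in> {l..r}"
  then show "sqdist3 a b c x = min ((x - b)\<^sup>2) ((x - c)\<^sup>2)"
    using sq_le_sq_right [OF assms(1), of x] assms(3) by (auto simp: sqdist3_def min_def)
qed

text \<open>The case distinction follows the position of the point \<open>1\<close>, where the density changes, relative
  to the two Voronoi boundaries.\<close>

lemma distortion3_ge:
  assumes "a \<le> b" "b \<le> c"
  shows "mid_poly opt_mid \<le> distortion3 a b c"
proof -
  let ?I = "integral {0..1} (sqdist3 a b c)" and ?J = "integral {1..2} (sqdist3 a b c)"
  have I0: "0 \<le> ?I" and J0: "0 \<le> ?J" by (rule integral_sqdist3_nonneg)+
  consider (mid) "(a + b) / 2 \<le> 1" "1 \<le> (b + c) / 2" | (low) "(b + c) / 2 < 1" | (high) "1 < (a + b) / 2"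
    by linarith
  then show ?thesis
  proof cases
    case mid
    note I = integral_sqdist3_eq_left [OF assms mid(2), of 0]
    note J = integral_sqdist3_eq_right [OF assms mid(1), of 2]
    consider "b < 0" | "2 < b" | "0 \<le> b" "b \<le> 2" by linarith
    then show ?thesis
    proof cases
      case 1
      \<comment> \<open>Here \<open>c > 2\<close>, so on \<open>[0, 1]\<close> no point is nearer than \<open>0\<close> would be.\<close>
      have "1 / 3 = integral {0..1} (\<lambda>x. (x - 0 :: real)\<^sup>2)"
        using has_integral_sq [of 0 1 0] by (simp add: integral_unique)
      also have "\<dots> \<le> ?I"
      proof (rule integral_le [OF _ integrable_sqdist3])
        fix x :: real assume "x \<in> {0..1}"
        with 1 assms mid(2) show "(x - 0)\<^sup>2 \<le> sqdist3 a b c x"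
          by (auto simp: sqdist3_def abs_le_square_iff [symmetric])
      qed (intro integrable_continuous_real continuous_intros)
      finally show ?thesis using mid_poly_opt_mid_less J0 by (simp add: distortion3_def)
    next
      case 2
      have "1 / 3 = integral {1..2} (\<lambda>x. (x - 2 :: real)\<^sup>2)"
        using has_integral_sq [of 1 2 2] by (simp add: integral_unique)
      also have "\<dots> \<le> ?J"
        unfolding J
      proof (rule integral_le)
        fix x :: real assume "x \<in> {1..2}"
        with 2 assms show "(x - 2)\<^sup>2 \<le> min ((x - b)\<^sup>2) ((x - c)\<^sup>2)"
          by (auto simp: abs_le_square_iff [symmetric])
      qed (intro integrable_continuous_real continuous_intros)+
      finally show ?thesis using mid_poly_opt_mid_less I0 by (simp add: distortion3_def)
    next
      case 3
      have "((b - 0)^3 + 9 * (1 - b)^3) / 27 \<le> ?I"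
        unfolding I by (rule integral_min_sq_ge_left) (use assms mid 3 in auto)
      moreover have "((2 - b)^3 + 9 * (b - 1)^3) / 27 \<le> ?J"
        unfolding J by (rule integral_min_sq_ge_right) (use assms mid 3 in auto)
      moreover have "((b - 0)^3 + 9 * (1 - b)^3) / 27 / 3 + 2 * (((2 - b)^3 + 9 * (b - 1)^3) / 27) / 3
          = mid_poly b"
        by (simp add: mid_poly_def field_simps power2_eq_square power3_eq_cube)
      ultimately show ?thesis
        using mid_poly_ge [OF 3(1)] unfolding distortion3_def by argo
    qed
  next
    case low
    have "?J = integral {1..2} (\<lambda>x. (x - c)\<^sup>2)"
    proof (rule integral_cong)
      fix x :: real assume "x \<in> {1..2}"
      then show "sqdist3 a b c x = (x - c)\<^sup>2"
        using sq_le_sq_right [of b c x] sq_le_sq_right [of a c x] low assms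
        by (auto simp: sqdist3_def min_def)
    qed
    also have "\<dots> \<ge> (2 - 1)^3 / 12" by (rule integral_sq_ge) simp
    finally show ?thesis using mid_poly_opt_mid_less I0 by (simp add: distortion3_def)
  next
    case high
    have I: "?I = integral {0..1} (\<lambda>x. (x - a)\<^sup>2)"
    proof (rule integral_cong)
      fix x :: real assume "x \<in> {0..1}"
      then show "sqdist3 a b c x = (x - a)\<^sup>2"
        using sq_le_sq_left [of a b x] sq_le_sq_left [of a c x] high assms
        by (auto simp: sqdist3_def min_def)
    qed
    show ?thesis
    proof (cases "a \<le> 1")
      case True
      have "(1 - 0)^3 / 12 \<le> ?I" unfolding I by (rule integral_sq_ge) simp
      \<comment> \<open>With \<open>h = 1/5\<close> the bound on \<open>[1, 2]\<close> is \<open>1/75\<close>.\<close>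
      moreover have "(1/5)\<^sup>2 * (2 - 1) - 10 * (1/5)^3 / 3 \<le> ?J"
        by (rule integral_sqdist3_ge_anchored) (use True in auto)
      ultimately show ?thesis
        using mid_poly_opt_mid_less by (simp add: distortion3_def power2_eq_square power3_eq_cube)
    next
      case False
      have "1 / 3 = integral {0..1} (\<lambda>x. (x - 1 :: real)\<^sup>2)"
        using has_integral_sq [of 0 1 1] by (simp add: integral_unique)
      also have "\<dots> \<le> ?I" unfolding I
      proof (rule integral_le)
        fix x :: real assume "x \<in> {0..1}"
        with False show "(x - 1)\<^sup>2 \<le> (x - a)\<^sup>2"
          by (auto simp: abs_le_square_iff [symmetric])
      qed (intro integrable_continuous_real continuous_intros)+
      finally show ?thesis using mid_poly_opt_mid_less J0 by (simp add: distortion3_def)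
    qed
  qed
qed

text \<open>Equality in the lower bounds: \<open>opt_mid / 3\<close> is one third of the way from \<open>0\<close> to the middle
  point, and \<open>(4 + opt_mid) / 3 = 2 - (2 - opt_mid) / 3\<close> is one third of the way from \<open>2\<close> to it.\<close>

lemma distortion3_opt:
  "distortion3 (opt_mid / 3) opt_mid ((4 + opt_mid) / 3) = mid_poly opt_mid"
proof -
  let ?b = opt_mid
  have b: "1 < ?b" "?b < 5/4" using sqrt17_bounds by (auto simp: opt_mid_def)
  have "integral {0..1} (sqdist3 (?b / 3) ?b ((4 + ?b) / 3))
      = integral {0..1} (\<lambda>x. min ((x - ?b / 3)\<^sup>2) ((x - ?b)\<^sup>2))"
    by (rule integral_sqdist3_eq_left) (use b in \<open>auto simp: field_simps\<close>)
  also have "\<dots> = (((?b - ?b / 3) / 2)^3 * 2 + (?b / 3 - 0)^3 + (1 - ?b)^3) / 3"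
    by (rule integral_min_sq) (use b in \<open>auto simp: field_simps\<close>)
  finally have I: "integral {0..1} (sqdist3 (?b / 3) ?b ((4 + ?b) / 3)) = \<dots>" .
  have "integral {1..2} (sqdist3 (?b / 3) ?b ((4 + ?b) / 3))
      = integral {1..2} (\<lambda>x. min ((x - ?b)\<^sup>2) ((x - (4 + ?b) / 3)\<^sup>2))"
    by (rule integral_sqdist3_eq_right) (use b in \<open>auto simp: field_simps\<close>)
  also have "\<dots> = ((((4 + ?b) / 3 - ?b) / 2)^3 * 2 + (?b - 1)^3 + (2 - (4 + ?b) / 3)^3) / 3"
    by (rule integral_min_sq) (use b in \<open>auto simp: field_simps\<close>)
  finally have J: "integral {1..2} (sqdist3 (?b / 3) ?b ((4 + ?b) / 3)) = \<dots>" .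
  show ?thesis
    unfolding distortion3_def I J mid_poly_def
    by (simp add: field_simps power2_eq_square power3_eq_cube)
qed

lemma sorted_triple_of_card_le_3:
  fixes A :: "'a :: linorder set"
  assumes "1 \<le> card A" "card A \<le> 3"
  obtains a b c where "a \<le> b" "b \<le> c" "A = {a, b, c}"
proof -
  have fin: "finite A" using assms(1) by (metis card.infinite not_one_le_zero)
  define xs where "xs = sorted_list_of_set A"
  have xs: "sorted xs" "set xs = A" "length xs = card A"
    using fin by (auto simp: xs_def)
  then consider x where "xs = [x]" | x y where "xs = [x, y]" | x y z where "xs = [x, y, z]"
    using assms by (cases xs rule: remdups_adj.cases; force simp: length_Suc_conv numeral_eq_Suc le_Suc_eq)
  then show ?thesis
    using xs(1,2) that by cases (force+)
qed

lemma rounds_to_I: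
  fixes k :: int
  assumes "of_int k - 1/2 \<le> 10 ^ d * x" "10 ^ d * x < of_int k + 1/2" "of_int k / 10 ^ d = r"
  shows "rounds_to d x r"
proof -
  have "round (10 ^ d * x) = k"
    unfolding round_def by (rule floor_unique) (use assms in auto)
  with assms(3) show ?thesis by (simp add: rounds_to_def)
qed

theorem proposition2p9p3:
  shows "\<exists>a1 a2 a3 v :: real.
    a1 < a2 \<and> a2 < a3 \<and>
    optimal_set_of_means 3 P_mix {a1, a2, a3} \<and>
    rounds_to 6 a1 0.380129 \<and>
    rounds_to 5 a2 1.14039 \<and>
    rounds_to 5 a3 1.71346 \<and>
    quantization_error 3 P_mix = ennreal v \<and>
    rounds_to 7 v 0.0343006"
proof (intro exI conjI)
  let ?\<alpha> = "{opt_mid / 3, opt_mid, (4 + opt_mid) / 3}"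
  show 1: "opt_mid / 3 < opt_mid" and 2: "opt_mid < (4 + opt_mid) / 3"
    using sqrt17_bounds by (auto simp: opt_mid_def field_simps)
  have card: "card ?\<alpha> = 3" using 1 2 by (auto simp: card_insert_if)
  have dist: "distortion P_mix ?\<alpha> = ennreal (mid_poly opt_mid)"
    by (simp only: distortion_P_mix distortion3_opt)
  show qe: "quantization_error 3 P_mix = ennreal (mid_poly opt_mid)"
    unfolding quantization_error_def
  proof (rule antisym)
    show "(INF \<alpha>\<in>{\<alpha>. 1 \<le> card \<alpha> \<and> card \<alpha> \<le> 3}. distortion P_mix \<alpha>) \<le> ennreal (mid_poly opt_mid)"
      unfolding dist [symmetric] by (rule INF_lower) (simp add: card)
    show "ennreal (mid_poly opt_mid) \<le> (INF \<alpha>\<in>{\<alpha>. 1 \<le> card \<alpha> \<and> card \<alpha> \<le> 3}. distortion P_mix \<alpha>)"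
    proof (rule INF_greatest)
      fix \<alpha> :: "real set"
      assume "\<alpha> \<in> {\<alpha>. 1 \<le> card \<alpha> \<and> card \<alpha> \<le> 3}"
      then obtain a b c where "a \<le> b" "b \<le> c" "\<alpha> = {a, b, c}"
        using sorted_triple_of_card_le_3 [of \<alpha>] by auto
      then show "ennreal (mid_poly opt_mid) \<le> distortion P_mix \<alpha>"
        by (simp only: distortion_P_mix) (rule ennreal_leI [OF distortion3_ge])
    qed
  qed
  show "optimal_set_of_means 3 P_mix ?\<alpha>"
    unfolding optimal_set_of_means_def dist qe card by simp
  show "rounds_to 6 (opt_mid / 3) 0.380129"
    by (rule rounds_to_I [where k = 380129]) (use sqrt17_bounds in \<open>auto simp: opt_mid_def\<close>)
  show "rounds_to 5 opt_mid 1.14039"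
    by (rule rounds_to_I [where k = 114039]) (use sqrt17_bounds in \<open>auto simp: opt_mid_def\<close>)
  show "rounds_to 5 ((4 + opt_mid) / 3) 1.71346"
    by (rule rounds_to_I [where k = 171346]) (use sqrt17_bounds in \<open>auto simp: opt_mid_def\<close>)
  show "rounds_to 7 (mid_poly opt_mid) 0.0343006"
    unfolding mid_poly_opt_mid
    by (rule rounds_to_I [where k = 343006]) (use sqrt17_bounds in \<open>auto simp: opt_mid_def\<close>)
qed

end
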